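(* Let $c:\mathbb{R}^n\to\mathbb{R}$ be convex and continuous, let $s\in\mathbb{R}^n$ satisfy $c(s)<0$, and suppose that $C=\{x\in\mathbb{R}^n:c(x)\le0\}$ is compact (and convex). Let $X\subset\mathbb{R}^n$ be a bounded set containing the iterates $x^k$ under consideration. Suppose that $T:C\to\mathbb{R}^n$ is single-valued and Lipschitz continuous on $C$: $$\|T(y)-T(z)\|\le L_T\|y-z\|\qquad\forall y,z\in C,$$ and set $$M_T:=\sup_{y\in C}\|T(y)\|,\qquad R_{XC}:=\sup\{\|x-y\|:x\in X,\ y\in C\}.$$ Let $Y_k\subset C$ be finite sets satisfying $\sup_{y\in C}\operatorname{dist}(y,Y_k)\le\delta_k$ with $\delta_k\to0$. If $$y^k\in\operatorname*{arg\,max}_{y\in Y_k}\langle T(y),x^k-y\rangle,\qquad v^k=T(y^k),$$ with trial point $\widetilde y^k=y^k$, then the oracle condition defined in the context holds with $\sigma=1$ and $$\varepsilon_k=(L_T R_{XC}+M_T)\,\delta_k .$$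
   Context: $[t]_+=\max\{t,0\}$; $\operatorname{dist}(y,Y)=\inf_{z\in Y}\|y-z\|$ (the finite sets $Y_k$ are nonempty). For a single-valued $T$, the Minty gap is $\Phi(x)=\sup_{z\in C}\langle T(z),x-z\rangle$ and $\Phi_+(x)=\max\{\Phi(x),0\}$. Oracle condition with parameters $\sigma\in(0,1]$ and $\varepsilon_k\ge0$, $\varepsilon_k\to0$: for every $x^k$ the oracle returns a trial point $\widetilde y^k$; with $\lambda_k=0$ if $c(\widetilde y^k)\le0$ and $\lambda_k=\frac{c(\widetilde y^k)}{c(\widetilde y^k)-c(s)}$ if $c(\widetilde y^k)>0$, one has $y^k=(1-\lambda_k)\widetilde y^k+\lambda_k s$ (Slater correction), and $v^k=T(y^k)$. Whenever $(x^k)$ is bounded, the sequences $(y^k)$ and $(v^k)$ are bounded and $[\langle v^k,x^k-y^k\rangle]_+\ge\sigma\Phi_+(x^k)-\varepsilon_k$ for all $k$. *)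

theory Defs
  imports "HOL-Analysis.Analysis"
begin

text \<open>
  Operators \<open>T : C \<rightarrow> \<real>\<^sup>n\<close> are rendered as total functions of which only the values on \<open>C\<close> matter.
  The supremum below is taken in the reals: it is the intended one when \<open>C\<close> is nonempty and
  \<open>T\<close> is bounded on the bounded set \<open>C\<close>.
\<close>

definition minty_gap :: "(real ^ 'n) set \<Rightarrow> (real ^ 'n \<Rightarrow> real ^ 'n) \<Rightarrow> real ^ 'n \<Rightarrow> real" where
  "minty_gap C T x = (SUP z\<in>C. T z \<bullet> (x - z))"

definition minty_gap_pos :: "(real ^ 'n) set \<Rightarrow> (real ^ 'n \<Rightarrow> real ^ 'n) \<Rightarrow> real ^ 'n \<Rightarrow> real" where
  "minty_gap_pos C T x = max (minty_gap C T x) 0"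

definition slater_weight :: "(real ^ 'n \<Rightarrow> real) \<Rightarrow> real ^ 'n \<Rightarrow> real ^ 'n \<Rightarrow> real" where
  "slater_weight c s yt = (if c yt \<le> 0 then 0 else c yt / (c yt - c s))"

definition slater_correction :: "(real ^ 'n \<Rightarrow> real) \<Rightarrow> real ^ 'n \<Rightarrow> real ^ 'n \<Rightarrow> real ^ 'n" where
  "slater_correction c s yt =
     (1 - slater_weight c s yt) *\<^sub>R yt + slater_weight c s yt *\<^sub>R s"

text \<open>
  \<open>x\<close> are the iterates, \<open>yt\<close> the trial points returned by the oracle, \<open>y\<close> the corrected points
  and \<open>v\<close> the operator values, for single-valued \<open>T\<close>.
\<close>

definition oracle_condition ::
  "(real ^ 'n \<Rightarrow> real) \<Rightarrow> real ^ 'n \<Rightarrow> (real ^ 'n) set \<Rightarrow> (real ^ 'n \<Rightarrow> real ^ 'n) \<Rightarrow>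
   real \<Rightarrow> (nat \<Rightarrow> real) \<Rightarrow>
   (nat \<Rightarrow> real ^ 'n) \<Rightarrow> (nat \<Rightarrow> real ^ 'n) \<Rightarrow> (nat \<Rightarrow> real ^ 'n) \<Rightarrow> (nat \<Rightarrow> real ^ 'n) \<Rightarrow> bool"
where
  "oracle_condition c s C T \<sigma> \<epsilon> x yt y v \<longleftrightarrow>
     0 < \<sigma> \<and> \<sigma> \<le> 1 \<and> (\<forall>k. 0 \<le> \<epsilon> k) \<and> \<epsilon> \<longlonglongrightarrow> 0 \<and>
     (\<forall>k. y k = slater_correction c s (yt k)) \<and>
     (\<forall>k. v k = T (y k)) \<and>
     (bounded (range x) \<longrightarrow>
        bounded (range y) \<and> bounded (range v) \<and>
        (\<forall>k. max (v k \<bullet> (x k - y k)) 0 \<ge> \<sigma> * minty_gap_pos C T (x k) - \<epsilon> k))"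

end

theory Submission
  imports Defs
begin

text \<open>
  Move from \<open>z \<in> C\<close> to a nearest point \<open>w\<close> of the net \<open>Y\<^sub>k\<close> by writing
  \<open>\<langle>T z, x - z\<rangle> = \<langle>T w, x - w\<rangle> + \<langle>T z - T w, x - z\<rangle> + \<langle>T w, w - z\<rangle>\<close>; the last two terms
  cost at most \<open>L\<^sub>T R\<^sub>X\<^sub>C \<delta>\<^sub>k\<close> and \<open>M\<^sub>T \<delta>\<^sub>k\<close>, and the first is at most its maximum over \<open>Y\<^sub>k\<close>.
\<close>

lemma inner_lipschitz_perturbation:
  fixes T :: "'a::real_inner \<Rightarrow> 'a"
  assumes lip: "L-lipschitz_on C T" and "z \<in> C" "w \<in> C"
    and M: "norm (T w) \<le> M" and R: "norm (x - z) \<le> R" and d: "norm (z - w) \<le> d"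
  shows "T z \<bullet> (x - z) \<le> T w \<bullet> (x - w) + (L * R + M) * d"
proof -
  have L: "0 \<le> L" using lip by (rule lipschitz_on_nonneg)
  have d0: "0 \<le> d" using d norm_ge_zero order_trans by blast
  have "norm (T z - T w) \<le> L * norm (z - w)"
    using lipschitz_onD[OF lip \<open>z \<in> C\<close> \<open>w \<in> C\<close>] by (simp add: dist_norm)
  also have "\<dots> \<le> L * d" using d L by (rule mult_left_mono)
  finally have "norm (T z - T w) * norm (x - z) \<le> (L * d) * R"
    using R L d0 by (intro mult_mono) auto
  then have 1: "(T z - T w) \<bullet> (x - z) \<le> (L * d) * R"
    using norm_cauchy_schwarz order_trans by blast
  have "norm (T w) * norm (w - z) \<le> M * d"
    using M d order_trans[OF norm_ge_zero M] by (intro mult_mono) (auto simp: norm_minus_commute)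
  then have 2: "T w \<bullet> (w - z) \<le> M * d"
    using norm_cauchy_schwarz order_trans by blast
  have "T z \<bullet> (x - z) = T w \<bullet> (x - w) + (T z - T w) \<bullet> (x - z) + T w \<bullet> (w - z)"
    by (simp add: inner_diff_left inner_diff_right)
  with 1 2 show ?thesis by (simp add: algebra_simps)
qed

text \<open>A real \<open>SUP\<close> dominates its members only when the family is bounded above;
  this lets the covering hypothesis be read pointwise. Any fixed \<open>a \<in> A\<close> bounds
  \<open>infdist u A\<close> by \<open>dist u a\<close>, and for empty \<open>A\<close> the value is
  0 by convention.\<close>

lemma bdd_above_infdist_image:
  assumes "bounded C"
  shows "bdd_above ((\<lambda>u. infdist u A) ` C)"
proof (cases "A = {}")
  case True
  then show ?thesis by (auto simp: infdist_def)
next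
  case False
  then obtain a where "a \<in> A" by auto
  from assms obtain e where "\<And>u. u \<in> C \<Longrightarrow> dist a u \<le> e"
    using bounded_any_center[where a = a] by blast
  then show ?thesis
    by (intro bdd_aboveI2[where M = e]) (metis \<open>a \<in> A\<close> dist_commute infdist_le order_trans)
qed

theorem proposition6p3:
  fixes c :: "real ^ 'n \<Rightarrow> real"
    and s :: "real ^ 'n"
    and C X :: "(real ^ 'n) set"
    and T :: "real ^ 'n \<Rightarrow> real ^ 'n"
    and L_T M_T R_XC :: real
    and x y v :: "nat \<Rightarrow> real ^ 'n"
    and Y :: "nat \<Rightarrow> (real ^ 'n) set"
    and \<delta> :: "nat \<Rightarrow> real"
  assumes "convex_on UNIV c" and "continuous_on UNIV c"
    and "c s < 0"
    and "C = {u. c u \<le> 0}" and "compact C" and "convex C"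
    and "bounded X" and "\<And>k. x k \<in> X"
    and "L_T-lipschitz_on C T"
    and "M_T = (SUP u\<in>C. norm (T u))"
    and "R_XC = Sup {norm (p - q) | p q. p \<in> X \<and> q \<in> C}"
    and "\<And>k. finite (Y k)" and "\<And>k. Y k \<noteq> {}" and "\<And>k. Y k \<subseteq> C"
    and "\<And>k. (SUP u\<in>C. infdist u (Y k)) \<le> \<delta> k"
    and "\<delta> \<longlonglongrightarrow> 0"
    and "\<And>k. is_arg_max (\<lambda>u. T u \<bullet> (x k - u)) (\<lambda>u. u \<in> Y k) (y k)"
    and "\<And>k. v k = T (y k)"
  shows "oracle_condition c s C T 1 (\<lambda>k. (L_T * R_XC + M_T) * \<delta> k) x y y v"
proof -
  \<comment> \<open>The Slater point witnesses that \<open>C\<close> is nonempty; the signs of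
    \<open>R_XC\<close>, \<open>M_T\<close> and \<open>\<delta> k\<close> are read off at it
    below.\<close>
  have sC: "s \<in> C" using assms(3,4) by simp
  have bC: "bounded C" using assms(5) by (rule compact_imp_bounded)
  have L: "0 \<le> L_T" using assms(9) by (rule lipschitz_on_nonneg)
  \<comment> \<open>A Lipschitz image of a compact set is compact. This makes \<open>M_T\<close> a
    genuine upper bound and later also bounds \<open>v\<close>.\<close>
  have bT: "bounded (T ` C)"
    using assms(5,9) by (intro compact_imp_bounded compact_continuous_image lipschitz_on_continuous_on)
  have M: "norm (T u) \<le> M_T" if "u \<in> C" for u
    unfolding assms(10)
    using that bT by (intro cSUP_upper) (auto simp: bounded_iff bdd_above_def)
  have bddR: "bdd_above {norm (p - q) | p q. p \<in> X \<and> q \<in> C}"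
  proof -
    obtain a b where "\<And>p. p \<in> X \<Longrightarrow> norm p \<le> a" "\<And>q. q \<in> C \<Longrightarrow> norm q \<le> b"
      using assms(7) bC by (auto simp: bounded_iff)
    then have "norm (p - q) \<le> a + b" if "p \<in> X" "q \<in> C" for p q
      using that norm_triangle_ineq4[of p q] by (meson add_mono order_trans)
    then show ?thesis by (auto intro!: bdd_aboveI[where M = "a + b"])
  qed
  have R: "norm (x k - q) \<le> R_XC" if "q \<in> C" for k q
    unfolding assms(11) using that assms(8) bddR by (intro cSup_upper) auto
  have \<delta>: "infdist u (Y k) \<le> \<delta> k" if "u \<in> C" for u k
    using cSUP_upper[OF that bdd_above_infdist_image[OF bC]] assms(15) order_trans by blast
  have coeff: "0 \<le> L_T * R_XC + M_T"
    using L R[OF sC] M[OF sC] by (meson add_nonneg_nonneg mult_nonneg_nonneg norm_ge_zero order_trans)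
  have \<delta>0: "0 \<le> \<delta> k" for k
    using \<delta>[OF sC] infdist_nonneg order_trans by blast
  have yY: "y k \<in> Y k" for k
    using assms(17)[of k] by (simp add: is_arg_max_def)
  have yC: "y k \<in> C" for k
    using yY assms(14) by blast
  have ymax: "T w \<bullet> (x k - w) \<le> T (y k) \<bullet> (x k - y k)" if "w \<in> Y k" for w k
    using assms(17)[of k] that by (auto simp: is_arg_max_linorder)
  have gap: "minty_gap C T (x k) \<le> T (y k) \<bullet> (x k - y k) + (L_T * R_XC + M_T) * \<delta> k" for k
    unfolding minty_gap_def
  proof (rule cSUP_least)
    show "C \<noteq> {}" using sC by auto
  next
    fix z assume z: "z \<in> C"
    \<comment> \<open>A finite nonempty net is closed, so the distance from \<open>z\<close> is
      attained and no approximation error beyond \<open>\<delta> k\<close> appears.\<close>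
    obtain w where w: "w \<in> Y k" "infdist z (Y k) = dist z w"
      using infdist_attains_inf[OF finite_imp_closed[OF assms(12)] assms(13)] by blast
    have "T z \<bullet> (x k - z) \<le> T w \<bullet> (x k - w) + (L_T * R_XC + M_T) * \<delta> k"
    proof (rule inner_lipschitz_perturbation[OF assms(9) z])
      show "w \<in> C" using w(1) assms(14) by blast
      then show "norm (T w) \<le> M_T" by (rule M)
      show "norm (x k - z) \<le> R_XC" using z by (rule R)
      show "norm (z - w) \<le> \<delta> k" using \<delta>[OF z, of k] w(2) by (simp add: dist_norm)
    qed
    also have "\<dots> \<le> T (y k) \<bullet> (x k - y k) + (L_T * R_XC + M_T) * \<delta> k"
      using ymax[OF w(1)] by simp
    finally show "T z \<bullet> (x k - z) \<le> T (y k) \<bullet> (x k - y k) + (L_T * R_XC + M_T) * \<delta> k" .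
  qed
  have eps0: "0 \<le> (L_T * R_XC + M_T) * \<delta> k" for k
    using coeff \<delta>0 by simp
  \<comment> \<open>Net points are feasible, so the Slater weight is 0 and the correction leaves the
    trial point unchanged.\<close>
  have "c (y k) \<le> 0" for k
    using yC assms(4) by auto
  then have "y k = slater_correction c s (y k)" for k
    by (simp add: slater_correction_def slater_weight_def)
  moreover have "(\<lambda>k. (L_T * R_XC + M_T) * \<delta> k) \<longlonglongrightarrow> 0"
    using assms(16) by (rule tendsto_mult_right_zero)
  moreover have "bounded (range y)" "bounded (range v)"
    using yC assms(18) by (auto intro: bounded_subset[OF bC] bounded_subset[OF bT])
  \<comment> \<open>If the gap is positive, \<open>gap\<close> applies; otherwise its positive part
    is 0 and the left side is at most 0 because the error term is nonnegative.\<close>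
  moreover have "1 * minty_gap_pos C T (x k) - (L_T * R_XC + M_T) * \<delta> k \<le> max (v k \<bullet> (x k - y k)) 0" for k
    using gap[of k] eps0[of k] assms(18)[of k] by (auto simp: minty_gap_pos_def max_def)
  ultimately show ?thesis
    using eps0 assms(18) unfolding oracle_condition_def by auto
qed

end
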